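(* Let $(A,\rho)$ be a compact infinite metric space. Then, for each integer $N\ge 2$, there exists an $N$-point best-packing configuration $\omega_N$ on $A$ such that $\gamma(\omega_N,A)\le 1$. In particular, $\gamma(\omega_N,A)\le 1$ holds for any $N$-point best-packing configuration $\omega_N=\{x_1,\ldots,x_N\}$ on $A$ which has, among all $N$-point best-packing configurations on $A$, the minimal number of unordered pairs of points $\{x_i,x_j\}$, $i\neq j$, such that $\rho(x_i,x_j)=\delta_N(A)$.
   Context: For a configuration $\omega_N=\{x_i\}_{i=1}^N\subset A$ of $N\ge 2$ distinct points in a compact infinite metric space $(A,\rho)$: the separation distance is $\delta(\omega_N):=\min_{1\le i\ne j\le N}\rho(x_i,x_j)$; the mesh norm (covering radius) relative to $A$ is $\eta(\omega_N,A):=\max_{y\in A}\min_{1\le i\le N}\rho(y,x_i)$; the mesh-separation ratio is $\gamma(\omega_N,A):=\eta(\omega_N,A)/\delta(\omega_N)$. The $N$-point best-packing distance on $A$ is $\delta_N(A):=\max\{\delta(\omega_N):\omega_N\subset A,\ \#\omega_N=N\}$, and an $N$-point configuration $\omega_N\subset A$ is called a best-packing configuration if $\delta(\omega_N)=\delta_N(A)$. *)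

theory Defs
  imports "HOL-Analysis.Analysis"
begin

text \<open>
  A compact metric space is a compact set \<open>A\<close> in a type of class \<open>metric_space\<close>, with the metric
  \<open>\<rho>\<close> given by \<^const>\<open>dist\<close> restricted to \<open>A\<close>. A configuration of \<open>N\<close> distinct points is a
  finite set of cardinality \<open>N\<close>.
\<close>

definition configurations :: "'a::metric_space set \<Rightarrow> nat \<Rightarrow> 'a set set" where
  "configurations A N = {\<omega>. \<omega> \<subseteq> A \<and> finite \<omega> \<and> card \<omega> = N}"

text \<open>Meaningful for finite \<open>\<omega>\<close> with at least two points.\<close>

definition separation_distance :: "'a::metric_space set \<Rightarrow> real" where
  "separation_distance \<omega> = Min {dist x y |x y. x \<in> \<omega> \<and> y \<in> \<omega> \<and> x \<noteq> y}"

text \<open>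
  The two maxima over infinite index sets are written as suprema. In the mesh norm the supremum is
  attained, because \<open>y \<mapsto> Min (dist y ` \<omega>)\<close> is continuous on the compact set \<open>A\<close>. In the
  best-packing distance it is over a nonempty set bounded by the diameter of \<open>A\<close> when \<open>A\<close> is
  compact and infinite and \<open>N \<ge> 2\<close>; that it is attained is exactly the existence of a best-packing
  configuration.
\<close>

definition mesh_norm :: "'a::metric_space set \<Rightarrow> 'a set \<Rightarrow> real" where
  "mesh_norm \<omega> A = (SUP y\<in>A. Min ((\<lambda>x. dist y x) ` \<omega>))"

definition mesh_separation_ratio :: "'a::metric_space set \<Rightarrow> 'a set \<Rightarrow> real" where
  "mesh_separation_ratio \<omega> A = mesh_norm \<omega> A / separation_distance \<omega>"

definition best_packing_distance :: "'a::metric_space set \<Rightarrow> nat \<Rightarrow> real" where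
  "best_packing_distance A N = (SUP \<omega>\<in>configurations A N. separation_distance \<omega>)"

definition best_packing :: "'a::metric_space set \<Rightarrow> nat \<Rightarrow> 'a set \<Rightarrow> bool" where
  "best_packing A N \<omega> \<longleftrightarrow>
     \<omega> \<in> configurations A N \<and> separation_distance \<omega> = best_packing_distance A N"

definition closest_pairs :: "'a::metric_space set \<Rightarrow> nat \<Rightarrow> 'a set \<Rightarrow> 'a set set" where
  "closest_pairs A N \<omega> =
     {{x, y} |x y. x \<in> \<omega> \<and> y \<in> \<omega> \<and> x \<noteq> y \<and> dist x y = best_packing_distance A N}"

end

theory Submission
  imports Defs
begin

text \<open>
  If some \<open>z \<in> A\<close> is farther than \<open>\<delta>\<^sub>N(A)\<close> from every point of a best-packing
  configuration, then moving one point of a closest pair to \<open>z\<close> gives another best-packing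
  configuration with strictly fewer closest pairs. Best-packing configurations exist
  by compactness of the space of \<open>A\<close>-valued sequences, of which only the first \<open>N\<close> terms matter.
\<close>

lemma finite_distances:
  assumes "finite \<omega>"
  shows "finite {dist x y |x y. x \<in> \<omega> \<and> y \<in> \<omega> \<and> x \<noteq> y}"
  by (rule finite_subset[of _ "(\<lambda>(x, y). dist x y) ` (\<omega> \<times> \<omega>)"]) (use assms in auto)

lemma distances_nonempty:
  assumes "card \<omega> \<ge> 2"
  shows "{dist x y |x y. x \<in> \<omega> \<and> y \<in> \<omega> \<and> x \<noteq> y} \<noteq> {}"
proof -
  have "\<exists>x\<in>\<omega>. \<exists>y\<in>\<omega>. x \<noteq> y"
    using assms card_le_Suc0_iff_eq[of \<omega>] by (cases "finite \<omega>") auto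
  then show ?thesis by auto
qed

lemma separation_distance_le:
  assumes "finite \<omega>" "x \<in> \<omega>" "y \<in> \<omega>" "x \<noteq> y"
  shows "separation_distance \<omega> \<le> dist x y"
  unfolding separation_distance_def
  by (rule Min_le[OF finite_distances[OF assms(1)]]) (use assms in blast)

lemma separation_distance_attained:
  assumes "finite \<omega>" "card \<omega> \<ge> 2"
  obtains x y where "x \<in> \<omega>" "y \<in> \<omega>" "x \<noteq> y" "separation_distance \<omega> = dist x y"
  using Min_in[OF finite_distances[OF assms(1)] distances_nonempty[OF assms(2)]] that
  unfolding separation_distance_def by auto

lemma separation_distance_pos:
  assumes "finite \<omega>" "card \<omega> \<ge> 2"
  shows "separation_distance \<omega> > 0"
  by (rule separation_distance_attained[OF assms]) simp

lemma continuous_on_Min_image: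
  fixes g :: "'i \<Rightarrow> 'b::topological_space \<Rightarrow> 'c::linorder_topology"
  assumes "finite I" "I \<noteq> {}" "\<And>i. i \<in> I \<Longrightarrow> continuous_on S (g i)"
  shows "continuous_on S (\<lambda>f. Min ((\<lambda>i. g i f) ` I))"
  using assms by (induction rule: finite_ne_induct) (simp_all add: continuous_on_min)

text \<open>Tychonoff's theorem for a power of \<open>A\<close>, carried over from abstract
  topologies to the product topology on the function type.\<close>

lemma compact_PiE_UNIV:
  fixes A :: "'a::topological_space set"
  assumes "compact A"
  shows "compact (PiE (UNIV :: 'i set) (\<lambda>_. A))"
  using assms compactin_PiE[of "\<lambda>_::'i. euclidean :: 'a topology" UNIV "\<lambda>_. A"]
  by (simp add: euclidean_product_topology)

text \<open>Injectivity matches pairs of distinct points with pairs of distinct indices. The minimum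
  then runs over an index set independent of \<open>f\<close>, so its continuity in \<open>f\<close>
  can be studied.\<close>

lemma separation_distance_image:
  assumes "inj_on f I"
  shows "separation_distance (f ` I)
    = Min ((\<lambda>(i, j). dist (f i) (f j)) ` {(i, j). i \<in> I \<and> j \<in> I \<and> i \<noteq> j})"
proof -
  have "{dist x y |x y. x \<in> f ` I \<and> y \<in> f ` I \<and> x \<noteq> y}
    = (\<lambda>(i, j). dist (f i) (f j)) ` {(i, j). i \<in> I \<and> j \<in> I \<and> i \<noteq> j}"
    using assms by (auto simp: inj_on_def image_iff)
  then show ?thesis unfolding separation_distance_def by simp
qed

text \<open>A continuous extension of the separation distance to all sequences in \<open>A\<close>
  attains its maximum by compactness. The maximum is positive, so the maximizer does not collapse
  two points and is a genuine configuration.\<close>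

lemma max_separation_attained:
  fixes A :: "'a::metric_space set"
  assumes "compact A" "infinite A" "N \<ge> 2"
  obtains \<omega> where "\<omega> \<in> configurations A N"
    and "\<And>\<omega>'. \<omega>' \<in> configurations A N \<Longrightarrow> separation_distance \<omega>' \<le> separation_distance \<omega>"
proof -
  define I where "I = {..<N}"
  define P where "P = {(i, j). i \<in> I \<and> j \<in> I \<and> i \<noteq> j}"
  define m where "m f = Min ((\<lambda>(i, j). dist (f i) (f j)) ` P)" for f :: "nat \<Rightarrow> 'a"
  define S where "S = PiE (UNIV :: nat set) (\<lambda>_. A)"
  have finP: "finite P"
    by (rule finite_subset[of _ "I \<times> I"]) (auto simp: P_def I_def)
  have neP: "P \<noteq> {}"
  proof -
    have "(0, 1) \<in> P" using assms(3) by (auto simp: P_def I_def)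
    then show ?thesis by blast
  qed
  have "continuous_on S (\<lambda>f. dist (f i) (f j))" for i j
    by (intro continuous_intros continuous_on_product_coordinates[THEN continuous_on_subset]) auto
  then have cont: "continuous_on S m"
    unfolding m_def by (intro continuous_on_Min_image finP neP) auto
  have neS: "S \<noteq> {}" using assms(2) by (auto simp: S_def PiE_eq_empty_iff)
  obtain f where f: "f \<in> S" "\<And>g. g \<in> S \<Longrightarrow> m g \<le> m f"
    using continuous_attains_sup[OF compact_PiE_UNIV[OF assms(1), where 'i = nat, folded S_def] neS cont]
    by blast
  have le: "\<exists>g\<in>S. separation_distance \<omega> = m g" if "\<omega> \<in> configurations A N" for \<omega>
  proof -
    from that have \<omega>: "\<omega> \<subseteq> A" "finite \<omega>" "card \<omega> = N" by (auto simp: configurations_def)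
    then obtain h where h: "bij_betw h I \<omega>"
      using ex_bij_betw_nat_finite[OF \<omega>(2)] by (auto simp: I_def atLeast0LessThan)
    obtain a where a: "a \<in> A" using assms(2) by fastforce
    \<comment> \<open>The enumeration \<open>h\<close> is continued by the constant
      \<open>a\<close>, since a member of \<open>S\<close> must have all its values in
      \<open>A\<close>; \<open>m\<close> does not see these terms.\<close>
    define g where "g i = (if i \<in> I then h i else a)" for i
    have g: "bij_betw g I \<omega>" using h by (rule bij_betw_cong[THEN iffD1, rotated]) (simp add: g_def)
    have "g \<in> S" using h \<omega>(1) a by (fastforce simp: S_def g_def bij_betw_def)
    moreover have "separation_distance \<omega> = m g"
      using separation_distance_image[of g I] g by (auto simp: bij_betw_def m_def P_def)
    ultimately show ?thesis by blast
  qed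
  \<comment> \<open>Since \<open>A\<close> is infinite, some configuration of \<open>N\<close>
    points exists. Its positive separation distance bounds the maximum \<open>m f\<close> from
    below.\<close>
  obtain \<omega>0 where \<omega>0: "\<omega>0 \<subseteq> A" "finite \<omega>0" "card \<omega>0 = N"
    using infinite_arbitrarily_large[OF assms(2)] by blast
  then have "0 < separation_distance \<omega>0" using separation_distance_pos assms(3) by blast
  also obtain g where "g \<in> S" "separation_distance \<omega>0 = m g"
    using le \<omega>0 by (auto simp: configurations_def)
  then have "separation_distance \<omega>0 \<le> m f" using f(2) by simp
  finally have pos: "m f > 0" .
  have inj: "inj_on f I"
  proof (rule inj_onI, rule ccontr)
    fix i j assume ij: "i \<in> I" "j \<in> I" "f i = f j" "i \<noteq> j"
    then have "(i, j) \<in> P" by (simp add: P_def)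
    then have "m f \<le> dist (f i) (f j)"
      unfolding m_def by (intro Min_le) (use finP in \<open>auto intro: rev_image_eqI\<close>)
    then show False using pos ij(3) by simp
  qed
  show ?thesis
  proof (rule that[of "f ` I"])
    show "f ` I \<in> configurations A N"
      using inj f(1) by (auto simp: configurations_def card_image I_def S_def)
    show "separation_distance \<omega>' \<le> separation_distance (f ` I)" if "\<omega>' \<in> configurations A N" for \<omega>'
      using le[OF that] f(2) separation_distance_image[OF inj] by (auto simp: m_def P_def)
  qed
qed

text \<open>The supremum is known to be an upper bound only once the family is bounded above; the
  maximal separation distance supplies such a bound.\<close>

lemma separation_distance_le_best:
  fixes A :: "'a::metric_space set"
  assumes "compact A" "infinite A" "N \<ge> 2" "\<omega> \<in> configurations A N"
  shows "separation_distance \<omega> \<le> best_packing_distance A N"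
proof -
  obtain \<omega>1 :: "'a set" where "\<And>\<omega>'. \<omega>' \<in> configurations A N \<Longrightarrow> separation_distance \<omega>' \<le> separation_distance \<omega>1"
    using max_separation_attained[OF assms(1-3)] by blast
  then have "bdd_above (separation_distance ` configurations A N)" by (auto simp: bdd_above_def)
  then show ?thesis unfolding best_packing_distance_def using assms(4) by (rule cSUP_upper2) simp
qed

lemma best_packing_exists:
  assumes "compact A" "infinite A" "N \<ge> 2"
  obtains \<omega> where "best_packing A N \<omega>"
proof -
  obtain \<omega> where \<omega>: "\<omega> \<in> configurations A N"
    "\<And>\<omega>'. \<omega>' \<in> configurations A N \<Longrightarrow> separation_distance \<omega>' \<le> separation_distance \<omega>"
    using max_separation_attained[OF assms] by blast
  then have "best_packing_distance A N = separation_distance \<omega>"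
    unfolding best_packing_distance_def by (intro cSup_eq_maximum) auto
  then show ?thesis using that \<omega>(1) by (simp add: best_packing_def)
qed

text \<open>All distances from \<open>z\<close> to the old points exceed \<delta>, the best-packing
  distance. Replacing an endpoint \<open>a\<close> of a closest pair by \<open>z\<close> thus
  creates no pair at distance at most \<delta>, and it destroys the pair
  \<open>{a, b}\<close>.\<close>

lemma fewer_closest_pairs:
  assumes "compact A" "infinite A" "N \<ge> 2" "best_packing A N \<omega>"
    and "z \<in> A" and far: "\<And>x. x \<in> \<omega> \<Longrightarrow> best_packing_distance A N < dist z x"
  obtains \<omega>' where "best_packing A N \<omega>'"
    and "card (closest_pairs A N \<omega>') < card (closest_pairs A N \<omega>)"
proof -
  let ?d = "best_packing_distance A N"
  from assms(4) have \<omega>: "\<omega> \<subseteq> A" "finite \<omega>" "card \<omega> = N" "separation_distance \<omega> = ?d"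
    by (auto simp: best_packing_def configurations_def)
  obtain a b where ab: "a \<in> \<omega>" "b \<in> \<omega>" "a \<noteq> b" "?d = dist a b"
    using separation_distance_attained[of \<omega>] \<omega> assms(3) by metis
  have "z \<notin> \<omega>" using far[of z] ab(4) by (auto simp: not_less)
  define \<omega>' where "\<omega>' = insert z (\<omega> - {a})"
  have card': "finite \<omega>'" "card \<omega>' = N"
    using \<omega>(2,3) ab(1) \<open>z \<notin> \<omega>\<close> assms(3) by (auto simp: \<omega>'_def card_Diff_singleton)
  then have conf: "\<omega>' \<in> configurations A N"
    using \<omega>(1) assms(5) by (auto simp: configurations_def \<omega>'_def)
  \<comment> \<open>The bound is an inequality because it serves twice: for pairs at distance
    exactly \<delta>, and for a pair realizing the separation of \<open>\<omega>'\<close>, known at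
    first only to be at distance at most \<delta>.\<close>
  have near: "x \<in> \<omega> - {a} \<and> y \<in> \<omega> - {a}"
    if "x \<in> \<omega>'" "y \<in> \<omega>'" "x \<noteq> y" "dist x y \<le> ?d" for x y
    using that far[of x] far[of y] by (auto simp: \<omega>'_def dist_commute)
  obtain x y where xy: "x \<in> \<omega>'" "y \<in> \<omega>'" "x \<noteq> y" "separation_distance \<omega>' = dist x y"
    using separation_distance_attained[of \<omega>'] card' assms(3) by metis
  have "separation_distance \<omega>' \<le> ?d"
    by (rule separation_distance_le_best[OF assms(1-3) conf])
  \<comment> \<open>The closest pair of \<open>\<omega>'\<close> avoids \<open>z\<close>, so it
    already lies in \<open>\<omega>\<close> and its distance is at least \<delta>.\<close>
  moreover from this have "x \<in> \<omega>" "y \<in> \<omega>" using near[OF xy(1-3)] xy(4) by auto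
  then have "?d \<le> separation_distance \<omega>'"
    using separation_distance_le[OF \<omega>(2) _ _ xy(3)] \<omega>(4) xy(4) by simp
  ultimately have best: "best_packing A N \<omega>'" using conf by (simp add: best_packing_def)
  have "closest_pairs A N \<omega>' \<subseteq> closest_pairs A N \<omega>"
    using near unfolding closest_pairs_def by fastforce
  moreover have "{a, b} \<in> closest_pairs A N \<omega>"
    using ab unfolding closest_pairs_def by auto
  moreover have "{a, b} \<notin> closest_pairs A N \<omega>'"
    using \<open>z \<notin> \<omega>\<close> ab(1) by (auto simp: closest_pairs_def \<omega>'_def doubleton_eq_iff)
  moreover have "finite (closest_pairs A N \<omega>)"
    by (rule finite_subset[of _ "Pow \<omega>"]) (auto simp: closest_pairs_def \<omega>(2))
  ultimately have "card (closest_pairs A N \<omega>') < card (closest_pairs A N \<omega>)"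
    by (intro psubset_card_mono) auto
  then show ?thesis using that best by blast
qed

text \<open>A point of \<open>A\<close> farther than \<delta> from all of \<open>\<omega>\<close>
  would allow an exchange that lowers the number of closest pairs, against minimality. So the mesh
  norm is at most \<delta>, which is the separation distance of \<open>\<omega>\<close>.\<close>

lemma mesh_separation_ratio_le_1:
  assumes "compact A" "infinite A" "N \<ge> 2" "best_packing A N \<omega>"
    and min: "\<And>\<omega>'. best_packing A N \<omega>' \<Longrightarrow>
      card (closest_pairs A N \<omega>) \<le> card (closest_pairs A N \<omega>')"
  shows "mesh_separation_ratio \<omega> A \<le> 1"
proof -
  from assms(4) have \<omega>: "finite \<omega>" "card \<omega> = N" "separation_distance \<omega> = best_packing_distance A N"
    by (auto simp: best_packing_def configurations_def)
  then have "\<omega> \<noteq> {}" using assms(3) by auto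
  have "mesh_norm \<omega> A \<le> best_packing_distance A N"
    unfolding mesh_norm_def
  proof (rule cSUP_least)
    show "A \<noteq> {}" using assms(2) by auto
    fix z assume "z \<in> A"
    have "\<exists>x\<in>\<omega>. dist z x \<le> best_packing_distance A N"
    proof (rule ccontr)
      assume "\<not> ?thesis"
      then have "\<And>x. x \<in> \<omega> \<Longrightarrow> best_packing_distance A N < dist z x" by force
      then obtain \<omega>' where "best_packing A N \<omega>'"
        and "card (closest_pairs A N \<omega>') < card (closest_pairs A N \<omega>)"
        using fewer_closest_pairs[OF assms(1-4) \<open>z \<in> A\<close>] by metis
      then show False using min by (simp add: leD)
    qed
    then show "Min ((\<lambda>x. dist z x) ` \<omega>) \<le> best_packing_distance A N"
      using \<omega>(1) \<open>\<omega> \<noteq> {}\<close> by (subst Min_le_iff) auto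
  qed
  moreover have "separation_distance \<omega> > 0"
    using separation_distance_pos \<omega> assms(3) by blast
  ultimately show ?thesis by (simp add: mesh_separation_ratio_def \<omega>(3))
qed

theorem theorem1:
  fixes A :: "'a::metric_space set" and N :: nat
  assumes "compact A" and "infinite A" and "N \<ge> 2"
  shows "(\<exists>\<omega>. best_packing A N \<omega> \<and> mesh_separation_ratio \<omega> A \<le> 1) \<and>
         (\<forall>\<omega>. best_packing A N \<omega> \<and>
               (\<forall>\<omega>'. best_packing A N \<omega>' \<longrightarrow>
                      card (closest_pairs A N \<omega>) \<le> card (closest_pairs A N \<omega>')) \<longrightarrow>
               mesh_separation_ratio \<omega> A \<le> 1)"
proof (intro conjI allI impI)
  obtain \<omega>0 where "best_packing A N \<omega>0" by (rule best_packing_exists[OF assms])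
  \<comment> \<open>The number of closest pairs is a natural number, so a minimizer exists even if
    there are infinitely many best-packing configurations.\<close>
  from ex_has_least_nat[of "best_packing A N", OF this, of "\<lambda>\<omega>. card (closest_pairs A N \<omega>)"]
  obtain \<omega> where "best_packing A N \<omega>"
    "\<And>\<omega>'. best_packing A N \<omega>' \<Longrightarrow> card (closest_pairs A N \<omega>) \<le> card (closest_pairs A N \<omega>')"
    by auto
  then show "\<exists>\<omega>. best_packing A N \<omega> \<and> mesh_separation_ratio \<omega> A \<le> 1"
    by (intro exI conjI mesh_separation_ratio_le_1[OF assms])
qed (intro mesh_separation_ratio_le_1[OF assms]; simp)

end
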